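(* Let $n_z\ge 1$, $n_m\ge 1$ be integers, $n_b=2n_m$, $\beta>0$, $\epsilon>0$, $\underline q<\overline q$ real numbers, let $\mathcal D=\{(q(k),Z(k))\}_{k=1}^N\subset[\underline q,\overline q]\times\mathbb R^{n_z}$ be a finite nonempty data set, let $\omega:\mathbb R\times\mathbb R^{n_z}\to\mathbb R_{>0}$ be a weight function, and let $\boldsymbol\eta=\{0=\eta_1<\eta_2<\dots<\eta_{n_{\text{grid}}}=1\}$ be a finite grid of $[0,1]$. Let $B=(B^{(1)},\dots,B^{(n_b)})$ be the row vector of basis functions and $\xi$ the normalization map defined in the context. Then the linear program in the unknowns $\mu\in\mathbb R^{n_b}$, $L\in\mathbb R^{n_z}$, $$\min_{\mu,L}\ \max_{(q,Z)\in\mathcal D}\ \omega(q,Z)\cdot\left|B(\xi(q))\mu-Z^TL\right|\quad\text{s.t.}\quad \left[\frac{dB}{d\eta}(\eta_j)\right]\mu\ \ge\ \epsilon\quad\text{for all } j=1,\dots,n_{\text{grid}},$$ is feasible, i.e. there exists $(\mu,L)\in\mathbb R^{n_b}\times\mathbb R^{n_z}$ satisfying all of its constraints.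
   Context: Normalization: $\xi(q)=\dfrac{q-\underline q}{\overline q-\underline q}$. Coefficients: $\alpha_i:=e^{\beta(1-i)}-1$ for $i=1,\dots,n_m$. For $\eta\in[0,1]$ define $$B_1^{(i)}(\eta):=(1+\alpha_i)\frac{\eta}{1+\alpha_i\eta},\qquad B_2^{(i)}(\eta):=\frac{\eta}{1+\alpha_i(1-\eta)}.$$ The basis functions $B^{(1)},\dots,B^{(n_b)}$, $n_b=2n_m$, are, in this order: the constant function $B^{(1)}\equiv 1$; the functions $B_1^{(2)},\dots,B_1^{(n_m)}$; and the functions $B_2^{(1)},\dots,B_2^{(n_m)}$. $B(\eta)$ denotes the row vector $(B^{(1)}(\eta),\dots,B^{(n_b)}(\eta))$, so $B(\eta)\mu=\sum_{i=1}^{n_b}B^{(i)}(\eta)\mu_i$, and $\frac{dB}{d\eta}(\eta)$ is the row vector of derivatives. *)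

theory Defs
  imports "HOL-Analysis.Analysis"
begin

definition normalization :: "real \<Rightarrow> real \<Rightarrow> real \<Rightarrow> real" where
  "normalization qlo qhi q = (q - qlo) / (qhi - qlo)"

definition \<alpha>_coeff :: "real \<Rightarrow> nat \<Rightarrow> real" where
  "\<alpha>_coeff \<beta> i = exp (\<beta> * (1 - real i)) - 1"

definition B1 :: "real \<Rightarrow> nat \<Rightarrow> real \<Rightarrow> real" where
  "B1 \<beta> i \<eta> = (1 + \<alpha>_coeff \<beta> i) * (\<eta> / (1 + \<alpha>_coeff \<beta> i * \<eta>))"

definition B2 :: "real \<Rightarrow> nat \<Rightarrow> real \<Rightarrow> real" where
  "B2 \<beta> i \<eta> = \<eta> / (1 + \<alpha>_coeff \<beta> i * (1 - \<eta>))"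

(* Indices are 1-based: position 1 holds the constant, positions 2..n_m hold B1 with the same
   index, and positions n_m + 1 .. 2 * n_m hold B2 with indices 1..n_m. *)
definition basis :: "real \<Rightarrow> nat \<Rightarrow> nat \<Rightarrow> real \<Rightarrow> real" where
  "basis \<beta> n_m i =
     (if i = 1 then (\<lambda>_. 1) else if i \<le> n_m then B1 \<beta> i else B2 \<beta> (i - n_m))"

(* The basis functions live on the interval [0,1], hence the derivative within it
   (one-sided at the endpoints). *)
definition basis_deriv :: "real \<Rightarrow> nat \<Rightarrow> nat \<Rightarrow> real \<Rightarrow> real" where
  "basis_deriv \<beta> n_m i \<eta> = vector_derivative (basis \<beta> n_m i) (at \<eta> within {0..1})"

record 'v min_problem =
  decision_space :: "'v set"
  objective :: "'v \<Rightarrow> real"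
  constraints :: "'v \<Rightarrow> bool"

definition feasible :: "'v min_problem \<Rightarrow> bool" where
  "feasible P \<longleftrightarrow> (\<exists>v \<in> decision_space P. constraints P v)"

(* The length of the coefficient vector \<mu> depends on the number n_m, so \<mu> is a function on
   the index set {1..2 * n_m} (extensional, i.e. undefined outside it); the other vectors,
   of a fixed dimension CARD('z), are in real ^ 'z. *)
definition fit_program ::
  "nat \<Rightarrow> real \<Rightarrow> real \<Rightarrow> real \<Rightarrow> real \<Rightarrow> (real \<times> (real ^ 'z)) set \<Rightarrow> (real \<times> (real ^ 'z) \<Rightarrow> real)
    \<Rightarrow> nat \<Rightarrow> (nat \<Rightarrow> real) \<Rightarrow> ((nat \<Rightarrow> real) \<times> (real ^ 'z)) min_problem" where
  "fit_program n_m \<beta> \<epsilon> qlo qhi D \<omega> n_grid grid =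
    \<lparr> decision_space = ({1..2 * n_m} \<rightarrow>\<^sub>E UNIV) \<times> UNIV,
      objective = (\<lambda>(\<mu>, L). Max ((\<lambda>(q, Z). \<omega> (q, Z) *
         \<bar>(\<Sum>i = 1..2 * n_m. basis \<beta> n_m i (normalization qlo qhi q) * \<mu> i) - Z \<bullet> L\<bar>) ` D)),
      constraints = (\<lambda>(\<mu>, L). \<forall>j \<in> {1..n_grid}.
         (\<Sum>i = 1..2 * n_m. basis_deriv \<beta> n_m i (grid j) * \<mu> i) \<ge> \<epsilon>) \<rparr>"

end

theory Submission
  imports Defs
begin

text \<open>Since \<open>\<alpha>\<^sub>1 = 0\<close>, the basis function \<open>B\<^sub>2\<^sup>(\<^sup>1\<^sup>)\<close> is the identity and has derivative 1;
  taking \<open>\<epsilon>\<close> times it, and any \<open>L\<close>, satisfies every constraint.\<close>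

lemma B2_1: "B2 \<beta> 1 \<eta> = \<eta>"
  by (simp add: B2_def \<alpha>_coeff_def)

text \<open>Position \<open>Suc n_m\<close> is the first \<open>B2\<close> slot, which holds the
  identity; \<open>n_m \<ge> 1\<close> keeps it apart from the constant at position 1.\<close>

lemma basis_deriv_Suc:
  assumes "n_m \<ge> 1" and "\<eta> \<in> {0..1}"
  shows "basis_deriv \<beta> n_m (Suc n_m) \<eta> = 1"
proof -
  have "basis \<beta> n_m (Suc n_m) = (\<lambda>x. x)"
    using assms(1) B2_1 by (auto simp: basis_def)
  moreover have "((\<lambda>x::real. x) has_vector_derivative 1) (at \<eta> within {0..1})"
    by (rule has_vector_derivative_id)
  \<comment> \<open>The interval is nondegenerate, so the derivative within it is unique even at the
    endpoints.\<close>
  ultimately show ?thesis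
    using assms(2) unfolding basis_deriv_def
    by (intro vector_derivative_within_closed_interval) auto
qed

theorem proposition1:
  fixes n_m n_grid :: nat and \<beta> \<epsilon> qlo qhi :: real
    and D :: "(real \<times> (real ^ 'z)) set" and \<omega> :: "real \<times> (real ^ 'z) \<Rightarrow> real"
    and grid :: "nat \<Rightarrow> real"
  assumes "n_m \<ge> 1" and "\<beta> > 0" and "\<epsilon> > 0" and "qlo < qhi"
    and "finite D" and "D \<noteq> {}" and "D \<subseteq> {qlo..qhi} \<times> UNIV"
    and "\<And>x. \<omega> x > 0"
    and "n_grid \<ge> 2" and "grid 1 = 0" and "grid n_grid = 1"
    and "strict_mono_on {1..n_grid} grid"
  shows "feasible (fit_program n_m \<beta> \<epsilon> qlo qhi D \<omega> n_grid grid)"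
proof -
  \<comment> \<open>The restricted lambda makes \<open>\<mu>\<close> extensional, as the decision
    space demands.\<close>
  define \<mu> where "\<mu> = (\<lambda>i\<in>{1..2 * n_m}. if i = Suc n_m then \<epsilon> else 0)"
  have "(\<Sum>i = 1..2 * n_m. basis_deriv \<beta> n_m i (grid j) * \<mu> i) = \<epsilon>" if "j \<in> {1..n_grid}" for j
  proof -
    have mono: "mono_on {1..n_grid} grid"
      using assms(12) by (rule strict_mono_on_imp_mono_on)
    \<comment> \<open>The end values 0 and 1 of the monotone grid confine every grid point to the
      unit interval.\<close>
    have "grid 1 \<le> grid j" "grid j \<le> grid n_grid"
      using that by (auto intro!: mono_onD[OF mono])
    then have "grid j \<in> {0..1}"
      using assms(10,11) by simp
    then have "basis_deriv \<beta> n_m (Suc n_m) (grid j) = 1"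
      using assms(1) by (intro basis_deriv_Suc)
    moreover have "(\<Sum>i = 1..2 * n_m. basis_deriv \<beta> n_m i (grid j) * \<mu> i)
        = (\<Sum>i = 1..2 * n_m. if i = Suc n_m then basis_deriv \<beta> n_m i (grid j) * \<epsilon> else 0)"
      by (intro sum.cong) (auto simp: \<mu>_def)
    \<comment> \<open>From \<open>n_m \<ge> 1\<close> follows \<open>Suc n_m \<le> 2 * n_m\<close>,
      so the single nonzero term does occur in the sum.\<close>
    ultimately show ?thesis
      using assms(1) by simp
  qed
  moreover have "\<mu> \<in> {1..2 * n_m} \<rightarrow>\<^sub>E UNIV"
    by (simp add: \<mu>_def)
  ultimately show ?thesis
    unfolding feasible_def fit_program_def by (intro bexI[of _ "(\<mu>, 0)"]) auto
qed

end
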